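(* For every real $p > 0$, the set $\mathcal{INJ}(\ell_p) \setminus (\mathcal{CYC}(\ell_p) \cup \mathcal{DR}(\ell_p))$ contains, except for zero, an isometric copy of $\ell_p$; that is, there exists a linear map $\Phi : \ell_p \to \mathcal{L}(\ell_p)$ with $\|\Phi(\lambda)\| = \|\lambda\|_p$ for all $\lambda \in \ell_p$ and such that, for every $\lambda \in \ell_p \setminus \{0\}$, the operator $\Phi(\lambda)$ is injective, is not cyclic, and does not have dense range.
   Context: Let $\mathbb{K} = \mathbb{R}$ or $\mathbb{C}$. For $0 < p < \infty$, $\ell_p = \{(x_n) \in \mathbb{K}^{\mathbb{N}} : \sum_{n=1}^\infty |x_n|^p < \infty\}$. For $p \ge 1$ it is endowed with the norm $\|(x_n)\|_p = (\sum_{n=1}^\infty |x_n|^p)^{1/p}$; for $0 < p < 1$ it is endowed with the F-norm $\|(x_n)\|_p = \sum_{n=1}^\infty |x_n|^p$ and the corresponding metric $\|x-y\|_p$. $\mathcal{L}(\ell_p)$ is the vector space of all continuous linear operators $\ell_p \to \ell_p$, endowed with $\|T\| = \sup\{\|T(x)\|_p : \|x\|_p \le 1\}$ (the operator norm if $p \ge 1$, an F-norm if $0<p<1$) and the distance $d(T,S) = \|T-S\|$. An operator $T \in \mathcal{L}(X)$ is cyclic if there is $x_0 \in X$ such that $\mathrm{span}\{T^n x_0 : n \ge 0\}$ is dense in $X$. $\mathcal{CYC}(X)$, $\mathcal{DR}(X)$, $\mathcal{INJ}(X)$ are the sets of $T \in \mathcal{L}(X)$ that are cyclic, have dense range, are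 injective, respectively. *)

theory Defs
  imports "HOL-Analysis.Analysis" "HOL-Library.Function_Algebras"
begin

text \<open>
  Sequences are functions of type \<open>nat \<Rightarrow> 'k\<close>, indexed from 0, with the pointwise vector space
  operations. The scalar field \<open>'k\<close> is meant to be \<open>real\<close> or \<open>complex\<close>.
\<close>

definition ell :: "real \<Rightarrow> (nat \<Rightarrow> 'k::real_normed_field) set" where
  "ell p = {x. (\<lambda>n. norm (x n) powr p) summable_on UNIV}"

text \<open>The norm for \<open>p \<ge> 1\<close>, the F-norm for \<open>0 < p < 1\<close>. Outside \<open>ell p\<close> the infinite sum is 0 by
  convention; so the distance below is nonnegative and symmetric on the whole type, as the locale
  \<^locale>\<open>Metric_space\<close> demands.\<close>

definition lnorm :: "real \<Rightarrow> (nat \<Rightarrow> 'k::real_normed_field) \<Rightarrow> real" where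
  "lnorm p x = (if p \<ge> 1 then (\<Sum>\<^sub>\<infinity>n. norm (x n) powr p) powr (1 / p)
                else (\<Sum>\<^sub>\<infinity>n. norm (x n) powr p))"

definition ell_top :: "real \<Rightarrow> (nat \<Rightarrow> 'k::real_normed_field) topology" where
  "ell_top p = Metric_space.mtopology (ell p) (\<lambda>x y. lnorm p (x - y))"

definition seq_scale :: "'k::real_normed_field \<Rightarrow> (nat \<Rightarrow> 'k) \<Rightarrow> nat \<Rightarrow> 'k" where
  "seq_scale c x = (\<lambda>n. c * x n)"

definition op_scale ::
  "'k::real_normed_field \<Rightarrow> ((nat \<Rightarrow> 'k) \<Rightarrow> nat \<Rightarrow> 'k) \<Rightarrow> (nat \<Rightarrow> 'k) \<Rightarrow> nat \<Rightarrow> 'k" where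
  "op_scale c T = (\<lambda>x. seq_scale c (T x))"

text \<open>Linearity of a map defined on a linear subspace \<open>V\<close>; the library predicate
  \<^const>\<open>Vector_Spaces.linear\<close> only covers maps defined on a whole type.\<close>

definition linear_map_on ::
  "'v::ab_group_add set \<Rightarrow> ('k \<Rightarrow> 'v \<Rightarrow> 'v) \<Rightarrow> ('k \<Rightarrow> 'w \<Rightarrow> 'w) \<Rightarrow> ('v \<Rightarrow> 'w::ab_group_add) \<Rightarrow> bool" where
  "linear_map_on V s s' f \<longleftrightarrow>
     (\<forall>x\<in>V. \<forall>y\<in>V. f (x + y) = f x + f y) \<and> (\<forall>c. \<forall>x\<in>V. f (s c x) = s' c (f x))"

text \<open>
  The continuous linear operators on \<open>\<ell>\<^sub>p\<close>. An operator is represented by the total function that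
  agrees with it on \<open>\<ell>\<^sub>p\<close> and vanishes elsewhere, so that two operators are equal iff
  they are equal as functions and the vector space operations are the pointwise ones.
\<close>

definition lop :: "real \<Rightarrow> ((nat \<Rightarrow> 'k::real_normed_field) \<Rightarrow> nat \<Rightarrow> 'k) set" where
  "lop p = {T. T ` ell p \<subseteq> ell p \<and> linear_map_on (ell p) seq_scale seq_scale T \<and>
               continuous_map (ell_top p) (ell_top p) T \<and> (\<forall>x. x \<notin> ell p \<longrightarrow> T x = 0)}"

definition op_norm :: "real \<Rightarrow> ((nat \<Rightarrow> 'k::real_normed_field) \<Rightarrow> nat \<Rightarrow> 'k) \<Rightarrow> real" where
  "op_norm p T = (SUP x\<in>{x \<in> ell p. lnorm p x \<le> 1}. lnorm p (T x))"

definition dense_in_ell :: "real \<Rightarrow> (nat \<Rightarrow> 'k::real_normed_field) set \<Rightarrow> bool" where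
  "dense_in_ell p S \<longleftrightarrow> ell_top p closure_of S = ell p"

definition CYC :: "real \<Rightarrow> ((nat \<Rightarrow> 'k::real_normed_field) \<Rightarrow> nat \<Rightarrow> 'k) set" where
  "CYC p = {T \<in> lop p. \<exists>x\<^sub>0\<in>ell p. dense_in_ell p (module.span seq_scale {(T ^^ n) x\<^sub>0 | n. True})}"

definition DR :: "real \<Rightarrow> ((nat \<Rightarrow> 'k::real_normed_field) \<Rightarrow> nat \<Rightarrow> 'k) set" where
  "DR p = {T \<in> lop p. dense_in_ell p (T ` ell p)}"

definition INJ :: "real \<Rightarrow> ((nat \<Rightarrow> 'k::real_normed_field) \<Rightarrow> nat \<Rightarrow> 'k) set" where
  "INJ p = {T \<in> lop p. inj_on T (ell p)}"

text \<open>
  The locale predicates behind \<^const>\<open>module.span\<close> and \<^const>\<open>Metric_space.mtopology\<close>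
  hold, so these constants have their intended meaning above.
\<close>

lemma vector_space_seq_scale: "vector_space (seq_scale :: 'k::real_normed_field \<Rightarrow> _)"
  by unfold_locales (auto simp: seq_scale_def fun_eq_iff algebra_simps)

lemma powr_convex_comb:
  fixes a b t p :: real
  assumes "p \<ge> 1" "a \<ge> 0" "b \<ge> 0" "0 \<le> t" "t \<le> 1"
  shows "(t * a + (1 - t) * b) powr p \<le> t * a powr p + (1 - t) * b powr p"
proof -
  have aux: "(s * c) powr p \<le> s * c powr p" if "0 \<le> s" "s \<le> 1" "c \<ge> 0" for s c :: real
  proof -
    have "s powr p \<le> s"
      using that assms(1) powr_mono'[of 1 p s] by (cases "s = 0") auto
    then show ?thesis
      using that by (simp add: powr_mult mult_right_mono)
  qed
  show ?thesis
  proof (cases "a = 0 \<or> b = 0")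
    case True
    then show ?thesis
      using aux[of t a] aux[of "1 - t" b] assms by auto
  next
    case False
    then have "a \<in> {0<..}" "b \<in> {0<..}"
      using assms by auto
    then show ?thesis
      using convex_onD[OF powr_convex[OF assms(1)], of "1 - t" a b] assms by simp
  qed
qed

lemma powr_add_le_add_powr:
  fixes a b p :: real
  assumes "0 < p" "p \<le> 1" "a \<ge> 0" "b \<ge> 0"
  shows "(a + b) powr p \<le> a powr p + b powr p"
proof (cases "a + b = 0")
  case False
  define s where "s = a + b"
  have s: "s > 0" using False assms by (auto simp: s_def)
  have aux: "c / s * s powr p \<le> c powr p" if "0 \<le> c" "c \<le> s" for c
  proof -
    have "c / s \<le> (c / s) powr p"
      using that s assms powr_mono'[of p 1 "c / s"] by (cases "c = 0") auto
    then have "c / s * s powr p \<le> (c / s) powr p * s powr p"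
      by (intro mult_right_mono) auto
    also have "\<dots> = c powr p"
      using s that by (simp add: powr_divide)
    finally show ?thesis .
  qed
  have "(a / s + b / s) * s powr p \<le> a powr p + b powr p"
    using aux[of a] aux[of b] assms by (simp add: s_def distrib_right)
  moreover have "a / s + b / s = 1"
    using s by (simp add: s_def flip: add_divide_distrib)
  ultimately show ?thesis by (simp add: s_def)
qed (use assms in auto)

lemma lnorm_nonneg: "lnorm p x \<ge> 0"
  by (auto simp: lnorm_def intro!: infsum_nonneg)

lemma lnorm_minus_commute: "lnorm p (x - y) = lnorm p (y - x)"
  by (simp add: lnorm_def norm_minus_commute)

lemma lnorm_eq_0:
  assumes "p > 0" "x \<in> ell p" "lnorm p x = 0"
  shows "x = 0"
proof -
  have *: "(\<Sum>\<^sub>\<infinity>n. norm (x n) powr p) = 0"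
    using assms by (auto simp: lnorm_def split: if_splits)
  have "norm (x n) powr p = 0" for n
    by (rule nonneg_infsum_le_0D[where A = UNIV and f = "\<lambda>n. norm (x n) powr p"])
       (use * assms in \<open>auto simp: ell_def\<close>)
  then show ?thesis by (auto simp: fun_eq_iff)
qed

lemma lnorm_0 [simp]: "p > 0 \<Longrightarrow> lnorm p 0 = 0"
  by (simp add: lnorm_def)

lemma ell_uminus: "x \<in> ell p \<Longrightarrow> - x \<in> ell p"
  by (simp add: ell_def)

lemma ell_add_aux:
  assumes "p > 0" and x: "x \<in> ell p" and y: "y \<in> ell p"
  shows "x + y \<in> ell p \<and> lnorm p (x + y) \<le> lnorm p x + lnorm p y"
proof (cases "p \<ge> 1")
  case False
  have sum: "(\<lambda>n. norm (x n) powr p + norm (y n) powr p) summable_on UNIV"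
    using x y by (auto simp: ell_def intro: summable_on_add)
  have le: "norm ((x + y) n) powr p \<le> norm (x n) powr p + norm (y n) powr p" for n
  proof -
    have "norm ((x + y) n) powr p \<le> (norm (x n) + norm (y n)) powr p"
      using assms by (auto intro!: powr_mono2 norm_triangle_ineq)
    also have "\<dots> \<le> norm (x n) powr p + norm (y n) powr p"
      using assms False by (intro powr_add_le_add_powr) auto
    finally show ?thesis .
  qed
  have xy: "(\<lambda>n. norm ((x + y) n) powr p) summable_on UNIV"
    by (rule summable_on_comparison_test[OF sum]) (use le in auto)
  have "(\<Sum>\<^sub>\<infinity>n. norm ((x + y) n) powr p)
          \<le> (\<Sum>\<^sub>\<infinity>n. norm (x n) powr p + norm (y n) powr p)"
    by (rule infsum_mono[OF xy sum le])
  also have "\<dots> = (\<Sum>\<^sub>\<infinity>n. norm (x n) powr p) + (\<Sum>\<^sub>\<infinity>n. norm (y n) powr p)"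
    using x y by (intro infsum_add) (auto simp: ell_def)
  finally show ?thesis using xy False by (auto simp: ell_def lnorm_def)
next
  case True
  define X where "X = (\<Sum>\<^sub>\<infinity>n. norm (x n) powr p)"
  define Y where "Y = (\<Sum>\<^sub>\<infinity>n. norm (y n) powr p)"
  define a where "a = lnorm p x"
  define b where "b = lnorm p y"
  show ?thesis
  proof (cases "a = 0 \<or> b = 0")
    case True
    then have "x = 0 \<or> y = 0"
      using lnorm_eq_0 assms by (auto simp: a_def b_def)
    then show ?thesis using assms by auto
  next
    case False
    have ab: "a > 0" "b > 0"
      using False lnorm_nonneg[of p x] lnorm_nonneg[of p y] by (auto simp: a_def b_def)
    have XY: "X \<ge> 0" "Y \<ge> 0" by (auto simp: X_def Y_def intro!: infsum_nonneg)
    have aX: "a powr p = X" and bY: "b powr p = Y"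
      using True XY by (auto simp: a_def b_def X_def Y_def lnorm_def powr_powr)
    define t where "t = a / (a + b)"
    have t: "0 \<le> t" "t \<le> 1" "1 - t = b / (a + b)"
      using ab by (auto simp: t_def field_simps)
    define g where "g n = (a + b) powr p *
        (t / X * norm (x n) powr p + (1 - t) / Y * norm (y n) powr p)" for n
    have XY0: "X > 0" "Y > 0"
      using ab aX bY by (metis powr_gt_zero less_irrefl)+
    have le: "norm ((x + y) n) powr p \<le> g n" for n
    proof -
      have "norm ((x + y) n) powr p \<le> (norm (x n) + norm (y n)) powr p"
        using assms by (auto intro!: powr_mono2 norm_triangle_ineq)
      also have "norm (x n) + norm (y n)
                   = (a + b) * (t * (norm (x n) / a) + (1 - t) * (norm (y n) / b))"
      proof -
        have "(a + b) * t = a" "(a + b) * (1 - t) = b"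
          using ab unfolding t(3) by (simp_all add: t_def)
        then show ?thesis
          using ab by (simp add: distrib_left flip: mult.assoc)
      qed
      also have "\<dots> powr p
          = (a + b) powr p * (t * (norm (x n) / a) + (1 - t) * (norm (y n) / b)) powr p"
        using ab t by (intro powr_mult) 
      also have "\<dots> \<le> (a + b) powr p *
          (t * (norm (x n) / a) powr p + (1 - t) * (norm (y n) / b) powr p)"
        using ab t True by (intro mult_left_mono powr_convex_comb) auto
      also have "\<dots> = g n"
        using ab by (simp add: g_def powr_divide aX bY)
      finally show ?thesis .
    qed
    have hx: "((\<lambda>n. norm (x n) powr p) has_sum X) UNIV"
      and hy: "((\<lambda>n. norm (y n) powr p) has_sum Y) UNIV"
      using x y by (auto simp: ell_def X_def Y_def)
    have "(g has_sum (a + b) powr p * (t / X * X + (1 - t) / Y * Y)) UNIV"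
      unfolding g_def by (intro has_sum_cmult_right has_sum_add hx hy)
    then have g: "(g has_sum (a + b) powr p) UNIV"
      using XY0 by simp
    have xy: "(\<lambda>n. norm ((x + y) n) powr p) summable_on UNIV"
      by (rule summable_on_comparison_test[of g]) (use le g in \<open>auto simp: summable_on_def\<close>)
    have "(\<Sum>\<^sub>\<infinity>n. norm ((x + y) n) powr p) \<le> (a + b) powr p"
      by (rule has_sum_mono[OF _ g le]) (use xy in auto)
    then have "(\<Sum>\<^sub>\<infinity>n. norm ((x + y) n) powr p) powr (1 / p) \<le> ((a + b) powr p) powr (1 / p)"
      using assms by (intro powr_mono2) (auto intro!: infsum_nonneg)
    also have "\<dots> = a + b"
      using ab assms by (simp add: powr_powr)
    finally show ?thesis
      using xy True by (auto simp: ell_def lnorm_def a_def b_def)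
  qed
qed

lemma Metric_space_ell:
  assumes "p > 0"
  shows "Metric_space (ell p :: (nat \<Rightarrow> 'k::real_normed_field) set) (\<lambda>x y. lnorm p (x - y))"
proof
  have diff: "x - y \<in> ell p" if "x \<in> ell p" "y \<in> ell p" for x y :: "nat \<Rightarrow> 'k"
    using ell_add_aux[OF assms that(1) ell_uminus[OF that(2)]] by simp
  fix x y z :: "nat \<Rightarrow> 'k"
  show "0 \<le> lnorm p (x - y)" by (rule lnorm_nonneg)
  show "lnorm p (x - y) = lnorm p (y - x)" by (rule lnorm_minus_commute)
  assume xy: "x \<in> ell p" "y \<in> ell p"
  show "lnorm p (x - y) = 0 \<longleftrightarrow> x = y"
    using lnorm_eq_0[OF assms diff[OF xy]] assms by auto
  assume z: "z \<in> ell p"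
  show "lnorm p (x - z) \<le> lnorm p (x - y) + lnorm p (y - z)"
    using ell_add_aux[OF assms diff[OF xy] diff[OF xy(2) z]] by simp
qed

end

(* Fix a bijection of nat \<times> nat with the indices \<ge> 2 and let \<Phi>(\<mu>) x be the tensor product x \<otimes> \<mu>
   written along these indices. The power sum of x \<otimes> \<mu> is the product of those of x and \<mu>, so
   \<parallel>\<Phi>(\<mu>) x\<parallel> = \<parallel>x\<parallel> \<parallel>\<mu>\<parallel> also for the F-norm, and \<Phi>(\<mu>) is injective when \<mu> \<noteq> 0.
   The range misses the coordinates 0 and 1. For every vector x, some nonzero functional
   a y\<^sub>0 + b y\<^sub>1 vanishes at x; it vanishes on the range too, hence on the span of the orbit of x. *)

theory Submission
  imports Defs
begin

section \<open>Power sums and coordinate functionals on \<open>ell p\<close>\<close>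

definition pow_sum :: "real \<Rightarrow> (nat \<Rightarrow> 'k::real_normed_field) \<Rightarrow> real" where
  "pow_sum p x = (\<Sum>\<^sub>\<infinity>n. norm (x n) powr p)"

text \<open>Raising the power sum to this exponent gives the norm or the F-norm according to
  \<open>p\<close>, so one argument covers both cases.\<close>

definition lnorm_exponent :: "real \<Rightarrow> real" where
  "lnorm_exponent p = (if p \<ge> 1 then 1 / p else 1)"

lemma lnorm_exponent_pos: "p > 0 \<Longrightarrow> lnorm_exponent p > 0"
  by (simp add: lnorm_exponent_def)

lemma pow_sum_nonneg: "pow_sum p x \<ge> 0"
  by (auto simp: pow_sum_def intro: infsum_nonneg)

lemma lnorm_eq_powr: "lnorm p x = pow_sum p x powr lnorm_exponent p"
  using pow_sum_nonneg[of p x] by (simp add: lnorm_def pow_sum_def lnorm_exponent_def)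

lemma has_sum_pow_sum: "x \<in> ell p \<Longrightarrow> ((\<lambda>n. norm (x n) powr p) has_sum pow_sum p x) UNIV"
  by (simp add: ell_def pow_sum_def)

lemma
  assumes "((\<lambda>n. norm (x n) powr p) has_sum S) UNIV"
  shows ell_if_has_sum: "x \<in> ell p" and pow_sum_eqI: "pow_sum p x = S"
  using assms by (auto simp: ell_def pow_sum_def summable_on_def infsumI)

lemma zero_in_ell: "0 \<in> ell p"
  by (simp add: ell_def)

lemma ell_diff:
  assumes "p > 0" "x \<in> ell p" "y \<in> ell p"
  shows "x - y \<in> ell p"
  using ell_add_aux[OF assms(1,2) ell_uminus[OF assms(3)]] by simp

lemma seq_scale_in_ell: "x \<in> ell p \<Longrightarrow> seq_scale c x \<in> ell p"
  by (auto simp: ell_def seq_scale_def norm_mult powr_mult intro: summable_on_cmult_right)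

text \<open>One term of a nonnegative sum is at most the whole sum. The exponent
  \<open>p * lnorm_exponent p\<close> is 1 for p \<ge> 1 and \<open>p\<close> for p < 1.\<close>

lemma coordinate_powr_le_lnorm:
  assumes "p > 0" "x \<in> ell p"
  shows "norm (x n) powr (p * lnorm_exponent p) \<le> lnorm p x"
proof -
  have "((\<lambda>n. norm (x n) powr p) has_sum norm (x n) powr p) {n}"
    using has_sum_finite[of "{n}" "\<lambda>n. norm (x n) powr p"] by simp
  then have "norm (x n) powr p \<le> pow_sum p x"
    by (rule has_sum_mono_neutral[OF _ has_sum_pow_sum[OF assms(2)]]) auto
  then have "(norm (x n) powr p) powr lnorm_exponent p \<le> lnorm p x"
    using lnorm_exponent_pos[OF assms(1)] by (auto simp: lnorm_eq_powr intro: powr_mono2)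
  then show ?thesis by (simp add: powr_powr)
qed

lemma continuous_map_coordinate:
  assumes "p > 0"
  shows "continuous_map (ell_top p) euclidean (\<lambda>x. x n :: 'k::real_normed_field)"
proof -
  interpret Metric_space "ell p :: (nat \<Rightarrow> 'k) set" "\<lambda>x y. lnorm p (x - y)"
    by (rule Metric_space_ell[OF assms])
  define q where "q = p * lnorm_exponent p"
  have q: "q > 0"
    using assms lnorm_exponent_pos by (auto simp: q_def)
  \<comment> \<open>The radius \<open>e powr q\<close> is what the coordinate bound yields: a
    coordinate of size at least \<open>e\<close> forces \<open>lnorm\<close> to be at least
    \<open>e powr q\<close>.\<close>
  have "dist (a n) (x n) < e"
    if "a \<in> ell p" "x \<in> ell p" "e > 0" "lnorm p (a - x) < e powr q" for a x :: "nat \<Rightarrow> 'k" and e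
  proof (rule ccontr)
    assume "\<not> dist (a n) (x n) < e"
    then have "e powr q \<le> norm ((a - x) n) powr q"
      using q that by (intro powr_mono2) (auto simp: dist_norm)
    also have "\<dots> \<le> lnorm p (a - x)"
      unfolding q_def using assms that by (intro coordinate_powr_le_lnorm ell_diff)
    finally show False using that by simp
  qed
  then have "\<exists>d>0. \<forall>x. x \<in> ell p \<and> lnorm p (a - x) < d \<longrightarrow> dist (a n) (x n) < e"
    if "a \<in> ell p" "e > 0" for a :: "nat \<Rightarrow> 'k" and e
    using that by (intro exI[of _ "e powr q"]) auto
  then show ?thesis
    using metric_continuous_map[OF Met_TC.Metric_space_axioms, of "\<lambda>x. x n"]
    by (simp add: ell_top_def)
qed

section \<open>Unit vectors and an obstruction to density\<close>

definition unit_vec :: "nat \<Rightarrow> nat \<Rightarrow> 'k::real_normed_field" where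
  "unit_vec i = (\<lambda>n. if n = i then 1 else 0)"

lemma
  shows unit_vec_in_ell: "(unit_vec i :: nat \<Rightarrow> 'k::real_normed_field) \<in> ell p"
    and lnorm_unit_vec: "lnorm p (unit_vec i :: nat \<Rightarrow> 'k) = 1"
proof -
  have "((\<lambda>n. norm (unit_vec i n :: 'k) powr p) has_sum 1) {i}"
    using has_sum_finite[of "{i}" "\<lambda>n. norm (unit_vec i n :: 'k) powr p"]
    by (simp add: unit_vec_def)
  also have "?this \<longleftrightarrow> ((\<lambda>n. norm (unit_vec i n :: 'k) powr p) has_sum 1) UNIV"
    by (rule has_sum_cong_neutral) (auto simp: unit_vec_def)
  finally have "((\<lambda>n. norm (unit_vec i n :: 'k) powr p) has_sum 1) UNIV" .
  then show "(unit_vec i :: nat \<Rightarrow> 'k) \<in> ell p" "lnorm p (unit_vec i :: nat \<Rightarrow> 'k) = 1"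
    by (auto simp: lnorm_eq_powr pow_sum_eqI ell_if_has_sum)
qed

text \<open>The kernel of a continuous functional is closed, so a dense \<open>S\<close> inside it
  would make it all of \<open>ell p\<close>; but the functional takes the values \<open>c\<close>
  and \<open>d\<close> at the first two unit vectors.\<close>

lemma not_dense_if_annihilated:
  fixes c d :: "'k::real_normed_field"
  assumes "p > 0" "c \<noteq> 0 \<or> d \<noteq> 0" "\<And>y. y \<in> S \<Longrightarrow> c * y 0 + d * y 1 = 0"
  shows "\<not> dense_in_ell p S"
proof
  assume dense: "dense_in_ell p S"
  interpret Metric_space "ell p :: (nat \<Rightarrow> 'k) set" "\<lambda>x y. lnorm p (x - y)"
    by (rule Metric_space_ell[OF assms(1)])
  have top: "topspace (ell_top p) = (ell p :: (nat \<Rightarrow> 'k) set)"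
    by (simp add: ell_top_def)
  have scaled: "continuous_map (ell_top p) euclidean (\<lambda>y. b * y n)" for b :: 'k and n
    using continuous_map_compose[OF continuous_map_coordinate[OF assms(1)],
        of euclidean "\<lambda>t. b * t" n]
    by (simp add: o_def continuous_on_mult_left)
  have cont: "continuous_map (ell_top p) euclidean (\<lambda>y. c * y 0 + d * y 1)"
    by (intro continuous_map_add scaled)
  define K where "K = {y \<in> topspace (ell_top p). c * y 0 + d * y 1 \<in> {0}}"
  have K: "closedin (ell_top p) K"
    unfolding K_def by (rule closedin_continuous_map_preimage[OF cont]) auto
  \<comment> \<open>\<open>S\<close> may contain sequences outside \<open>ell p\<close>, whereas
    \<open>K\<close> lies in the topspace; intersecting first leaves the closure unchanged.\<close>
  have "ell p = ell_top p closure_of (topspace (ell_top p) \<inter> S)"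
    using dense unfolding dense_in_ell_def by (metis closure_of_restrict)
  also have "\<dots> \<subseteq> K"
    by (rule closure_of_minimal[OF _ K]) (use assms(3) in \<open>auto simp: K_def\<close>)
  finally have "unit_vec 0 \<in> K" "unit_vec 1 \<in> K"
    using unit_vec_in_ell by blast+
  then show False
    using assms(2) by (auto simp: K_def unit_vec_def)
qed

section \<open>The tensor operator: linearity, norm and injectivity\<close>

definition tensor_op ::
  "real \<Rightarrow> (nat \<Rightarrow> 'k::real_normed_field) \<Rightarrow> (nat \<Rightarrow> 'k) \<Rightarrow> nat \<Rightarrow> 'k" where
  "tensor_op p \<mu> x =
     (if x \<in> ell p then
        (\<lambda>m. if m < 2 then 0
             else x (fst (prod_decode (m - 2))) * \<mu> (snd (prod_decode (m - 2))))
      else 0)"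

lemma tensor_op_low: "m < 2 \<Longrightarrow> tensor_op p \<mu> x m = 0"
  by (simp add: tensor_op_def)

lemma tensor_op_prod_encode:
  "x \<in> ell p \<Longrightarrow> tensor_op p \<mu> x (prod_encode (n, k) + 2) = x n * \<mu> k"
  by (simp add: tensor_op_def)

lemma tensor_op_add_left: "tensor_op p (\<mu> + \<nu>) x = tensor_op p \<mu> x + tensor_op p \<nu> x"
  by (auto simp: tensor_op_def fun_eq_iff algebra_simps)

lemma tensor_op_scale_left: "tensor_op p (seq_scale c \<mu>) x = seq_scale c (tensor_op p \<mu> x)"
  by (auto simp: tensor_op_def seq_scale_def fun_eq_iff)

lemma linear_tensor_op:
  assumes "p > 0"
  shows "linear_map_on (ell p) seq_scale seq_scale (tensor_op p \<mu>)"
  unfolding linear_map_on_def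
proof (intro conjI ballI allI)
  fix x y :: "nat \<Rightarrow> 'a" assume "x \<in> ell p" "y \<in> ell p"
  then show "tensor_op p \<mu> (x + y) = tensor_op p \<mu> x + tensor_op p \<mu> y"
    using ell_add_aux[OF assms] by (auto simp: tensor_op_def fun_eq_iff algebra_simps)
next
  fix c and x :: "nat \<Rightarrow> 'a" assume "x \<in> ell p"
  then show "tensor_op p \<mu> (seq_scale c x) = seq_scale c (tensor_op p \<mu> x)"
    using seq_scale_in_ell[of x p c] unfolding tensor_op_def
    by (simp add: fun_eq_iff) (simp add: seq_scale_def)
qed

lemma tensor_op_diff:
  assumes "p > 0" "x \<in> ell p" "y \<in> ell p"
  shows "tensor_op p \<mu> (x - y) = tensor_op p \<mu> x - tensor_op p \<mu> y"
  using ell_diff[OF assms] assms by (auto simp: tensor_op_def fun_eq_iff algebra_simps)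

lemma
  assumes "p > 0" and \<mu>: "\<mu> \<in> ell p"
  shows tensor_op_in_ell: "tensor_op p \<mu> x \<in> ell p"
    and lnorm_tensor_op: "x \<in> ell p \<Longrightarrow> lnorm p (tensor_op p \<mu> x) = lnorm p x * lnorm p \<mu>"
proof -
  have *: "((\<lambda>m. norm (tensor_op p \<mu> x m) powr p) has_sum pow_sum p x * pow_sum p \<mu>) UNIV"
    if x: "x \<in> ell p"
  proof -
    define f where "f = (\<lambda>(n, k). norm (x n) powr p * norm (\<mu> k) powr p)"
    define h :: "nat \<times> nat \<Rightarrow> nat" where "h = (\<lambda>z. prod_encode z + 2)"
    \<comment> \<open>The double family \<open>f\<close> is summed row by row. Since its terms are
      nonnegative, summable rows with summable row sums give summability on the product.\<close>
    have rows: "((\<lambda>k. f (n, k)) has_sum norm (x n) powr p * pow_sum p \<mu>) UNIV" for n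
      unfolding f_def by (simp add: has_sum_cmult_right has_sum_pow_sum[OF \<mu>])
    have total: "((\<lambda>n. norm (x n) powr p * pow_sum p \<mu>) has_sum pow_sum p x * pow_sum p \<mu>) UNIV"
      by (intro has_sum_cmult_left has_sum_pow_sum x)
    have "f summable_on UNIV \<times> UNIV"
      by (rule summable_on_SigmaI[OF rows]) (use total in \<open>auto simp: summable_on_def f_def\<close>)
    then have "(f has_sum pow_sum p x * pow_sum p \<mu>) (UNIV \<times> UNIV)"
      by (intro has_sum_SigmaI[OF rows total])
    moreover have "f = (\<lambda>m. norm (tensor_op p \<mu> x m) powr p) \<circ> h"
      using tensor_op_prod_encode[OF x] by (auto simp: f_def h_def norm_mult powr_mult)
    moreover have "inj h"
      by (auto simp: h_def inj_def)
    ultimately have "((\<lambda>m. norm (tensor_op p \<mu> x m) powr p)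
                        has_sum pow_sum p x * pow_sum p \<mu>) (range h)"
      by (simp add: has_sum_reindex)
    \<comment> \<open>Only the indices 0 and 1 lie outside \<open>range h\<close>, and the entries
      there are 0.\<close>
    also have "?this \<longleftrightarrow> ?thesis"
    proof (rule has_sum_cong_neutral)
      fix m assume "m \<in> UNIV - range h"
      moreover have "m = h (prod_decode (m - 2))" if "m \<ge> 2"
        using that by (simp add: h_def)
      ultimately have "m < 2"
        by (metis DiffD2 not_le rangeI)
      then show "norm (tensor_op p \<mu> x m) powr p = 0"
        by (simp add: tensor_op_low)
    qed auto
    finally show ?thesis .
  qed
  show "tensor_op p \<mu> x \<in> ell p"
  proof (cases "x \<in> ell p")
    case True
    then show ?thesis by (rule ell_if_has_sum[OF *])
  next
    case False
    then show ?thesis using zero_in_ell by (simp add: tensor_op_def)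
  qed
  \<comment> \<open>The power sums multiply, and \<open>powr\<close> with a fixed exponent preserves
    products of nonnegative numbers.\<close>
  show "lnorm p (tensor_op p \<mu> x) = lnorm p x * lnorm p \<mu>" if "x \<in> ell p"
    using pow_sum_eqI[OF *[OF that]] by (simp add: lnorm_eq_powr powr_mult pow_sum_nonneg)
qed

text \<open>Continuity is a Lipschitz estimate: by linearity and the product formula, distances are
  multiplied by \<open>lnorm p \<mu>\<close>.\<close>

lemma tensor_op_in_lop:
  fixes \<mu> :: "nat \<Rightarrow> 'k::real_normed_field"
  assumes "p > 0" "\<mu> \<in> ell p"
  shows "tensor_op p \<mu> \<in> lop p"
proof -
  interpret Metric_space "ell p :: (nat \<Rightarrow> 'k) set" "\<lambda>x y. lnorm p (x - y)"
    by (rule Metric_space_ell[OF assms(1)])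
  have "\<exists>d>0. \<forall>x. x \<in> ell p \<and> lnorm p (a - x) < d
          \<longrightarrow> lnorm p (tensor_op p \<mu> a - tensor_op p \<mu> x) < e"
    if a: "a \<in> ell p" and "e > 0" for a e
  \<comment> \<open>Adding 1 keeps the denominator positive when \<open>\<mu>\<close> is 0.\<close>
  proof (intro exI[of _ "e / (lnorm p \<mu> + 1)"] conjI allI impI)
    have pos: "lnorm p \<mu> + 1 > 0"
      using lnorm_nonneg[of p \<mu>] by simp
    then show "e / (lnorm p \<mu> + 1) > 0"
      using that by simp
    fix x assume x: "x \<in> ell p \<and> lnorm p (a - x) < e / (lnorm p \<mu> + 1)"
    have "lnorm p (tensor_op p \<mu> a - tensor_op p \<mu> x) = lnorm p (a - x) * lnorm p \<mu>"
      using x a assms by (simp add: ell_diff lnorm_tensor_op flip: tensor_op_diff)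
    also have "\<dots> \<le> lnorm p (a - x) * (lnorm p \<mu> + 1)"
      by (simp add: mult_left_mono lnorm_nonneg)
    also have "\<dots> < e"
      using x pos by (simp add: pos_less_divide_eq)
    finally show "lnorm p (tensor_op p \<mu> a - tensor_op p \<mu> x) < e" .
  qed
  then have "continuous_map (ell_top p) (ell_top p) (tensor_op p \<mu>)"
    using tensor_op_in_ell[OF assms] unfolding ell_top_def
    by (subst metric_continuous_map[OF Metric_space_axioms]) auto
  moreover have "\<forall>x. x \<notin> ell p \<longrightarrow> tensor_op p \<mu> x = 0"
    by (simp add: tensor_op_def)
  ultimately show ?thesis
    using tensor_op_in_ell[OF assms] linear_tensor_op[OF assms(1)]
    by (auto simp: lop_def)
qed

text \<open>By the product formula no vector of the unit ball exceeds \<open>lnorm p \<mu>\<close>,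
  and \<open>unit_vec 0\<close> attains it.\<close>

lemma op_norm_tensor_op:
  fixes \<mu> :: "nat \<Rightarrow> 'k::real_normed_field"
  assumes "p > 0" "\<mu> \<in> ell p"
  shows "op_norm p (tensor_op p \<mu>) = lnorm p \<mu>"
  unfolding op_norm_def
proof (rule cSup_eq_maximum)
  have "lnorm p (tensor_op p \<mu> (unit_vec 0)) = lnorm p \<mu>"
    by (simp add: lnorm_tensor_op[OF assms] unit_vec_in_ell lnorm_unit_vec)
  then show "lnorm p \<mu> \<in> (\<lambda>x. lnorm p (tensor_op p \<mu> x)) ` {x \<in> ell p. lnorm p x \<le> 1}"
    by (intro image_eqI[of _ _ "unit_vec 0"]) (auto simp: unit_vec_in_ell lnorm_unit_vec)
qed (auto simp: lnorm_tensor_op[OF assms] lnorm_nonneg mult_left_le_one_le)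

text \<open>If \<open>\<mu> k\<close> is nonzero, the entries \<open>x n * \<mu> k\<close> of the
  image determine \<open>x\<close>.\<close>

lemma inj_on_tensor_op:
  assumes "\<mu> \<noteq> 0"
  shows "inj_on (tensor_op p \<mu>) (ell p)"
proof
  fix x y assume xy: "x \<in> ell p" "y \<in> ell p" "tensor_op p \<mu> x = tensor_op p \<mu> y"
  obtain k where "\<mu> k \<noteq> 0"
    using assms by (auto simp: fun_eq_iff)
  moreover have "x n * \<mu> k = y n * \<mu> k" for n
    using xy tensor_op_prod_encode by metis
  ultimately show "x = y" by auto
qed

section \<open>Failure of dense range and of cyclicity\<close>

lemma tensor_op_not_dense_range:
  fixes \<mu> :: "nat \<Rightarrow> 'k::real_normed_field"
  assumes "p > 0"
  shows "tensor_op p \<mu> \<notin> DR p"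
proof -
  have "\<not> dense_in_ell p (tensor_op p \<mu> ` ell p)"
    \<comment> \<open>The annihilating functional is coordinate 0.\<close>
    by (rule not_dense_if_annihilated[OF assms, of 1 0]) (auto simp: tensor_op_low)
  then show ?thesis by (simp add: DR_def)
qed

text \<open>Two free coordinates give a two-dimensional space of functionals vanishing on the range;
  vanishing at the starting vector is one linear condition more, so a nonzero functional
  survives.\<close>

lemma tensor_op_not_cyclic:
  fixes \<mu> :: "nat \<Rightarrow> 'k::real_normed_field"
  assumes "p > 0"
  shows "tensor_op p \<mu> \<notin> CYC p"
proof
  assume "tensor_op p \<mu> \<in> CYC p"
  then obtain x
    where dense: "dense_in_ell p (module.span seq_scale {(tensor_op p \<mu> ^^ n) x | n. True})"
    by (auto simp: CYC_def)
  interpret vector_space "seq_scale :: 'k \<Rightarrow> _"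
    by (rule vector_space_seq_scale)
  obtain c d where cd: "c \<noteq> 0 \<or> d \<noteq> 0" "c * x 0 + d * x 1 = 0"
  proof (cases "x 0 = 0")
    case True
    then show ?thesis using that[of 1 0] by simp
  next
    case False
    then show ?thesis using that[of "- x 1" "x 0"] by simp
  qed
  \<comment> \<open>For n = 0 this is the choice of \<open>c\<close> and \<open>d\<close>; later
    iterates lie in the range, where both coordinates are 0.\<close>
  have "c * (tensor_op p \<mu> ^^ n) x 0 + d * (tensor_op p \<mu> ^^ n) x 1 = 0" for n
    using cd by (cases n) (simp_all add: tensor_op_low)
  \<comment> \<open>The kernel being a subspace carries the vanishing from the orbit to its
    span.\<close>
  moreover have "subspace {y. c * y 0 + d * y 1 = 0}"
  proof (rule subspaceI)
    fix x y :: "nat \<Rightarrow> 'k"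
    assume "x \<in> {y. c * y 0 + d * y 1 = 0}" "y \<in> {y. c * y 0 + d * y 1 = 0}"
    then have "(c * x 0 + d * x 1) + (c * y 0 + d * y 1) = 0"
      by simp
    then show "x + y \<in> {y. c * y 0 + d * y 1 = 0}"
      by (simp add: algebra_simps)
  next
    fix b :: 'k and x :: "nat \<Rightarrow> 'k"
    assume "x \<in> {y. c * y 0 + d * y 1 = 0}"
    then have "b * (c * x 0 + d * x 1) = 0"
      by simp
    then show "seq_scale b x \<in> {y. c * y 0 + d * y 1 = 0}"
      by (simp add: seq_scale_def algebra_simps)
  qed simp
  ultimately have "span {(tensor_op p \<mu> ^^ n) x | n. True} \<subseteq> {y. c * y 0 + d * y 1 = 0}"
    by (intro span_minimal) auto
  then have "\<not> dense_in_ell p (span {(tensor_op p \<mu> ^^ n) x | n. True})"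
    by (intro not_dense_if_annihilated[OF assms cd(1)]) auto
  then show False using dense by blast
qed

text \<open>The scalar field is left general so that the real and the complex case are both
  instances.\<close>

lemma isometric_copy_tensor_op:
  assumes "p > 0"
  shows "\<exists>\<Phi> :: (nat \<Rightarrow> 'k::real_normed_field) \<Rightarrow> (nat \<Rightarrow> 'k) \<Rightarrow> nat \<Rightarrow> 'k.
           \<Phi> ` ell p \<subseteq> lop p \<and>
           linear_map_on (ell p) seq_scale op_scale \<Phi> \<and>
           (\<forall>\<mu>\<in>ell p. op_norm p (\<Phi> \<mu>) = lnorm p \<mu>) \<and>
           (\<forall>\<mu>\<in>ell p - {0}. \<Phi> \<mu> \<in> INJ p - (CYC p \<union> DR p))"
proof (intro exI[of _ "tensor_op p"] conjI)
  \<comment> \<open>Operators are compared as total functions; at arguments outside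
    \<open>ell p\<close> both sides are 0.\<close>
  show "linear_map_on (ell p) seq_scale op_scale (tensor_op p)"
    unfolding linear_map_on_def op_scale_def
    by (intro conjI ballI allI ext) (simp_all add: tensor_op_add_left tensor_op_scale_left)
qed (use assms in \<open>auto simp: INJ_def tensor_op_in_lop op_norm_tensor_op
       inj_on_tensor_op tensor_op_not_dense_range tensor_op_not_cyclic\<close>)

theorem theorem4p1:
  fixes p :: real
  assumes "p > 0"
  shows
    "(\<exists>\<Phi> :: (nat \<Rightarrow> real) \<Rightarrow> (nat \<Rightarrow> real) \<Rightarrow> nat \<Rightarrow> real.
        \<Phi> ` ell p \<subseteq> lop p \<and>
        linear_map_on (ell p) seq_scale op_scale \<Phi> \<and>
        (\<forall>\<mu>\<in>ell p. op_norm p (\<Phi> \<mu>) = lnorm p \<mu>) \<and>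
        (\<forall>\<mu>\<in>ell p - {0}. \<Phi> \<mu> \<in> INJ p - (CYC p \<union> DR p))) \<and>
     (\<exists>\<Phi> :: (nat \<Rightarrow> complex) \<Rightarrow> (nat \<Rightarrow> complex) \<Rightarrow> nat \<Rightarrow> complex.
        \<Phi> ` ell p \<subseteq> lop p \<and>
        linear_map_on (ell p) seq_scale op_scale \<Phi> \<and>
        (\<forall>\<mu>\<in>ell p. op_norm p (\<Phi> \<mu>) = lnorm p \<mu>) \<and>
        (\<forall>\<mu>\<in>ell p - {0}. \<Phi> \<mu> \<in> INJ p - (CYC p \<union> DR p)))"
  by (intro conjI isometric_copy_tensor_op assms)

end
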